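(* Let $\mathbb{X}$ be a uniformly convex Banach space. Then for every $0<\varepsilon<2$ there are $q>1$ and $0<\eta<1$ with the property that for every $f,g\in\mathbb{X}$ with (i) $\min\{\|f\|,\|g\|\}\ge(1-\eta)\max\{\|f\|,\|g\|\}$ and (ii) $\|f-g\|\ge\varepsilon\max\{\|f\|,\|g\|\}$, we have $\|f+g\|^q\le\|f\|^q+\|g\|^q$.
   Context: A norm is uniformly convex if for each $0<\varepsilon<2$ there is $\delta\in(0,1)$ such that $\|f\|,\|g\|\le1$ and $\|f-g\|\ge\varepsilon$ imply $\|f+g\|\le2(1-\delta)$. *)

theory Defs
  imports "HOL-Analysis.Analysis"
begin

(* The norm is that of the type class, so the property is indexed by the type, as in CARD('a). *)
definition uniformly_convex :: "'a::real_normed_vector itself \<Rightarrow> bool" where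
  "uniformly_convex _ \<longleftrightarrow>
     (\<forall>\<epsilon>::real. 0 < \<epsilon> \<and> \<epsilon> < 2 \<longrightarrow>
       (\<exists>\<delta>::real. 0 < \<delta> \<and> \<delta> < 1 \<and>
         (\<forall>f g::'a. norm f \<le> 1 \<and> norm g \<le> 1 \<and> norm (f - g) \<ge> \<epsilon> \<longrightarrow>
            norm (f + g) \<le> 2 * (1 - \<delta>))))"

end

theory Submission
  imports Defs
begin

text \<open>Let \<open>M\<close> be the larger of the two norms and \<open>\<delta>\<close> a modulus of convexity at \<open>\<epsilon>\<close>. By scaling,
  \<open>\<parallel>f + g\<parallel> \<le> 2 (1 - \<delta>) M\<close>. For \<open>\<eta> = \<delta> / 2\<close> both norms are at least \<open>m = (1 - \<eta>) M\<close>, so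
  \<open>\<parallel>f + g\<parallel> \<le> 2 r m\<close> with \<open>r = (1 - \<delta>) / (1 - \<eta>) < 1\<close>. Since \<open>2 r < 2\<close>, some \<open>q > 1\<close> still
  satisfies \<open>(2 r)\<^sup>q \<le> 2\<close>, whence \<open>\<parallel>f + g\<parallel>\<^sup>q \<le> 2 m\<^sup>q \<le> \<parallel>f\<parallel>\<^sup>q + \<parallel>g\<parallel>\<^sup>q\<close>.\<close>

lemma exists_powr_le_two:
  fixes r :: real
  assumes "0 < r" "r < 1"
  shows "\<exists>q>1. (2 * r) powr q \<le> 2"
proof (intro exI conjI)
  \<comment> \<open>chosen so that \<open>2 powr (q - 1) = 1 / r\<close>\<close>
  define q where "q = 1 - log 2 r"
  show "q > 1"
    using assms by (simp add: q_def)
  have "2 powr q = 2 / r"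
    using assms by (simp add: q_def powr_diff)
  \<comment> \<open>The divisor \<open>r\<close> is written \<open>r powr 1\<close> so that the
    quotient collapses to a power of \<open>r\<close> with positive exponent
    \<open>q - 1\<close>.\<close>
  then have "(2 * r) powr q = 2 * (r powr q / r powr 1)"
    using assms by (simp add: powr_mult)
  also have "r powr q / r powr 1 = r powr (q - 1)"
    by (rule powr_diff [symmetric])
  also have "2 * r powr (q - 1) \<le> 2"
    using assms \<open>q > 1\<close> by (simp add: powr_le1)
  finally show "(2 * r) powr q \<le> 2" .
qed

text \<open>Homogeneity of the norm: dividing \<open>f\<close> and \<open>g\<close> by
  \<open>M\<close> moves them into the unit ball. Allowing \<open>M = 0\<close>, where both vectors
  vanish, spares later case distinctions.\<close>

lemma uniformly_convex_scaled:
  assumes "uniformly_convex TYPE('a::real_normed_vector)" "0 < \<epsilon>" "\<epsilon> < 2"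
  obtains \<delta> :: real where "0 < \<delta>" "\<delta> < 1"
    "\<And>(f::'a) g M. norm f \<le> M \<Longrightarrow> norm g \<le> M \<Longrightarrow> norm (f - g) \<ge> \<epsilon> * M \<Longrightarrow>
      norm (f + g) \<le> 2 * (1 - \<delta>) * M"
proof -
  obtain \<delta> where \<delta>: "0 < \<delta>" "\<delta> < 1"
    and convex: "\<And>f g::'a. norm f \<le> 1 \<Longrightarrow> norm g \<le> 1 \<Longrightarrow> norm (f - g) \<ge> \<epsilon> \<Longrightarrow>
      norm (f + g) \<le> 2 * (1 - \<delta>)"
    using assms unfolding uniformly_convex_def by metis
  have "norm (f + g) \<le> 2 * (1 - \<delta>) * M"
    if le: "norm f \<le> M" "norm g \<le> M" and ge: "norm (f - g) \<ge> \<epsilon> * M" for f g :: 'a and M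
  proof (cases "M = 0")
    case True
    then show ?thesis using le by simp
  next
    case False
    then have "M > 0"
      using le(1) norm_ge_zero[of f] by linarith
    have diff: "norm (f /\<^sub>R M - g /\<^sub>R M) = norm (f - g) / M"
      and add: "norm (f /\<^sub>R M + g /\<^sub>R M) = norm (f + g) / M"
      using \<open>M > 0\<close>
      by (simp_all add: divide_inverse mult.commute flip: scaleR_diff_right scaleR_add_right)
    have "norm (f /\<^sub>R M + g /\<^sub>R M) \<le> 2 * (1 - \<delta>)"
      using le ge \<open>M > 0\<close> by (intro convex) (simp_all add: diff pos_le_divide_eq mult.commute divide_inverse_commute[symmetric])
    then show ?thesis
      using \<open>M > 0\<close> by (simp add: add pos_divide_le_eq)
  qed
  with \<delta> show thesis by (rule that)
qed

theorem lemma2p1: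
  assumes "uniformly_convex TYPE('a::banach)"
  shows "\<forall>\<epsilon>::real. 0 < \<epsilon> \<and> \<epsilon> < 2 \<longrightarrow>
    (\<exists>q \<eta>::real. q > 1 \<and> 0 < \<eta> \<and> \<eta> < 1 \<and>
      (\<forall>f g::'a.
        min (norm f) (norm g) \<ge> (1 - \<eta>) * max (norm f) (norm g) \<and>
        norm (f - g) \<ge> \<epsilon> * max (norm f) (norm g) \<longrightarrow>
        norm (f + g) powr q \<le> norm f powr q + norm g powr q))"
proof (intro allI impI, elim conjE)
  fix \<epsilon> :: real
  assume "0 < \<epsilon>" "\<epsilon> < 2"
  with assms obtain \<delta> where \<delta>: "0 < \<delta>" "\<delta> < 1"
    and convex: "\<And>(f::'a) g M. norm f \<le> M \<Longrightarrow> norm g \<le> M \<Longrightarrow> norm (f - g) \<ge> \<epsilon> * M \<Longrightarrow>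
      norm (f + g) \<le> 2 * (1 - \<delta>) * M"
    by (rule uniformly_convex_scaled) blast
  \<comment> \<open>Any value strictly between 0 and \<open>\<delta>\<close> would do:
    \<open>\<eta> < \<delta>\<close> is what makes \<open>r < 1\<close>.\<close>
  define \<eta> where "\<eta> = \<delta> / 2"
  define r where "r = (1 - \<delta>) / (1 - \<eta>)"
  have \<eta>: "0 < \<eta>" "\<eta> < 1" and r: "0 < r" "r < 1"
    using \<delta> by (simp_all add: \<eta>_def r_def field_simps)
  from r obtain q where q: "q > 1" "(2 * r) powr q \<le> 2"
    using exists_powr_le_two by blast
  have "norm (f + g) powr q \<le> norm f powr q + norm g powr q"
    if min: "min (norm f) (norm g) \<ge> (1 - \<eta>) * max (norm f) (norm g)"
      and sep: "norm (f - g) \<ge> \<epsilon> * max (norm f) (norm g)" for f g :: 'a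
  proof -
    define m where "m = (1 - \<eta>) * max (norm f) (norm g)"
    have m: "0 \<le> m" "m \<le> norm f" "m \<le> norm g"
      using min \<eta> by (simp_all add: m_def le_max_iff_disj)
    have "norm (f + g) \<le> 2 * (1 - \<delta>) * max (norm f) (norm g)"
      using sep by (intro convex) simp_all
    also have "\<dots> = 2 * r * m"
      using \<eta> by (simp add: r_def m_def)
    finally have "norm (f + g) powr q \<le> (2 * r * m) powr q"
      using q by (intro powr_mono2) simp_all
    also have "\<dots> = (2 * r) powr q * m powr q"
      using r m by (simp add: powr_mult)
    also have "\<dots> \<le> 2 * m powr q"
      using q by (intro mult_right_mono) simp_all
    \<comment> \<open>Each of the two copies of \<open>m powr q\<close> is absorbed by one norm, as
      \<open>m\<close> bounds both from below.\<close>
    also have "\<dots> \<le> norm f powr q + norm g powr q"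
      using powr_mono2[of q m "norm f"] powr_mono2[of q m "norm g"] q m by simp
    finally show ?thesis .
  qed
  with q(1) \<eta> show "\<exists>q \<eta>::real. q > 1 \<and> 0 < \<eta> \<and> \<eta> < 1 \<and>
      (\<forall>f g::'a.
        min (norm f) (norm g) \<ge> (1 - \<eta>) * max (norm f) (norm g) \<and>
        norm (f - g) \<ge> \<epsilon> * max (norm f) (norm g) \<longrightarrow>
        norm (f + g) powr q \<le> norm f powr q + norm g powr q)"
    by blast
qed

end
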